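(* Let $n \ge 1$ be an integer, let $\epsilon \in (0,1)$, and let $f, g : \{0,1\}^n \to \mathbb{R}^{\ge 0}$. Let $X$ be uniformly distributed on $\{0,1\}^n$, and let $Y$ be a random variable with values in $\{0,1\}^n$ such that, given $X$, for each $1 \le i \le n$ independently, $\Pr[X_i = Y_i] = \frac{1+\epsilon}{2}$. Then $$E[f(X)g(Y)] \le |f|_{1+\epsilon}\,|g|_{1+\epsilon}.$$
   Context: For $h : \{0,1\}^n \to \mathbb{R}$ and $p \ge 1$, $|h|_p = \left(E[|h|^p]\right)^{1/p} = \left(2^{-n}\sum_{x \in \{0,1\}^n} |h(x)|^p\right)^{1/p}$, the expectation being with respect to the uniform measure on $\{0,1\}^n$. $\mathbb{R}^{\ge 0}$ is the set of nonnegative real numbers. The condition on $(X,Y)$ means that, conditionally on any fixed value of $X$, the coordinates $Y_1,\dots,Y_n$ are independent, with $Y_i = X_i$ with probability $\frac{1+\epsilon}{2}$ and $Y_i = 1 - X_i$ with probability $\frac{1-\epsilon}{2}$. Equivalently, for all $x,y \in \{0,1\}^n$, $\Pr[X=x, Y=y] = 2^{-n}\left(\frac{1+\epsilon}{2}\right)^{a(x,y)}\left(\frac{1-\epsilon}{2}\right)^{d(x,y)}$, where $a(x,y)$ and $d(x,y)$ are the numbers of coordinates on which $x$ and $y$ agree and differ, respectively. *)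

theory Defs
  imports "HOL-Probability.Probability"
begin

text \<open>Points of the cube are extensional functions, so that two points are equal
  as soon as their coordinates with index in \<^term>\<open>{1..n}\<close> agree.\<close>

definition cube :: "nat \<Rightarrow> (nat \<Rightarrow> nat) set" where
  "cube n = {1..n} \<rightarrow>\<^sub>E {0, 1}"

definition cube_norm :: "nat \<Rightarrow> real \<Rightarrow> ((nat \<Rightarrow> nat) \<Rightarrow> real) \<Rightarrow> real" where
  "cube_norm n p h = (1 / 2 ^ n * (\<Sum>x\<in>cube n. \<bar>h x\<bar> powr p)) powr (1 / p)"

end

theory Submission imports Defs begin

text \<open>The inequality is the two-function form of the Bonami--Beckner hypercontractive inequality.
  Write \<open>p = 1 + \<epsilon>\<close>. The joint law of \<open>(X, Y)\<close> is a product over the coordinates, and the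
  inequality tensorises: splitting off one coordinate, the induction hypothesis bounds each of the
  four pairs of restrictions of \<open>f\<close> and \<open>g\<close> by a product of norms on the smaller cube, and the
  one-coordinate inequality (\<open>two_point_noise_bound\<close>), applied to these norms, combines the four
  bounds. This works because an \<open>L\<^sup>p\<close> norm on the large cube is the two-point \<open>L\<^sup>p\<close> norm of the norms
  of the restrictions (\<open>cube_norm_Suc\<close>), and because the noise kernel is nonnegative.

  For one coordinate, write \<open>f = m + dr\<close> and \<open>g = m' + d'r\<close> with \<open>r = \<plusminus>1\<close>. The noisy correlation is
  \<open>m m' + \<epsilon> d d'\<close>, so by Cauchy--Schwarz it is enough that
  \<open>(m\<^sup>2 + \<epsilon> d\<^sup>2)\<^sup>1\<^sup>/\<^sup>2\<close> is at most the two-point \<open>L\<^sup>p\<close> norm of \<open>f\<close>. That is where the exponent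
  \<open>1 + \<epsilon>\<close> comes from: after scaling to \<open>m = 1\<close> and \<open>d = y\<close>, where \<open>0 \<le> y \<le> 1\<close> may be assumed because \<open>f\<close> is
  nonnegative, Bernoulli's inequality gives
  \<open>(1 + \<epsilon> y\<^sup>2)\<^sup>p\<^sup>/\<^sup>2 \<le> 1 + p \<epsilon> y\<^sup>2 / 2\<close>, and the right-hand side is exactly the second-order Taylor
  polynomial of \<open>((1+y)\<^sup>p + (1-y)\<^sup>p) / 2\<close>, which it does not exceed.\<close>

section \<open>The two-point inequality\<close>

lemma powr_add_powr_minus_ge_two:
  fixes y s :: real
  assumes "0 \<le> y" "y < 1" "s \<le> 0"
  shows "2 \<le> (1 + y) powr s + (1 - y) powr s"
proof -
  \<comment> \<open>The product of the two powers is at least 1, so their arithmetic mean is.\<close>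
  define a b where "a = (1 + y) powr (s/2)" and "b = (1 - y) powr (s/2)"
  have "(1 + y) * (1 - y) \<le> 1" by (simp add: algebra_simps)
  moreover have "0 < (1 + y) * (1 - y)" using assms by simp
  ultimately have "1 \<le> ((1 + y) * (1 - y)) powr (s/2)"
    using assms powr_mono2'[of "s/2" "(1 + y) * (1 - y)" 1] by simp
  then have ab: "1 \<le> a * b"
    using assms by (simp add: a_def b_def powr_mult)
  have "a\<^sup>2 = (1 + y) powr s" "b\<^sup>2 = (1 - y) powr s"
    using assms by (simp_all add: a_def b_def power2_eq_square flip: powr_add)
  moreover have "2 * (a * b) \<le> a\<^sup>2 + b\<^sup>2"
    using sum_squares_bound[of a b] by simp
  ultimately show ?thesis using ab by linarith
qed

lemma powr_diff_ge_linear: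
  fixes y s :: real
  assumes "0 \<le> y" "y \<le> 1" "0 < s" "s < 1"
  shows "2 * s * y \<le> (1 + y) powr s - (1 - y) powr s"
proof -
  let ?F = "\<lambda>y. (1 + y) powr s - (1 - y) powr s - 2 * s * y"
  have "?F 0 \<le> ?F y"
  proof (rule DERIV_nonneg_imp_increasing_open[where f = ?F])
    fix x assume x: "0 < x" "x < y"
    let ?D = "s * ((1 + x) powr (s - 1) + (1 - x) powr (s - 1) - 2)"
    have "(?F has_real_derivative ?D) (at x)"
      using x assms by (auto intro!: derivative_eq_intros simp: algebra_simps)
    moreover have "0 \<le> ?D"
      using x assms powr_add_powr_minus_ge_two[of x "s - 1"] by simp
    ultimately show "\<exists>d. (?F has_real_derivative d) (at x) \<and> 0 \<le> d" by blast
  next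
    show "continuous_on {0..y} ?F"
      using assms by (intro continuous_intros continuous_on_powr') auto
  qed (use assms in auto)
  then show ?thesis by simp
qed

text \<open>The binomial expansion of the right-hand side has only even powers of \<open>y\<close>, with nonnegative
  coefficients as the exponent \<open>1 + s\<close> lies between 1 and 2; the left-hand side is its truncation.
  Integrating the bound \<open>powr_add_powr_minus_ge_two\<close> on the second derivative twice avoids the
  series and its convergence at \<open>y = 1\<close>.\<close>

lemma powr_mean_ge_quadratic:
  fixes y s :: real
  assumes "0 \<le> y" "y \<le> 1" "0 < s" "s < 1"
  shows "1 + (1 + s) * s / 2 * y\<^sup>2 \<le> ((1 + y) powr (1 + s) + (1 - y) powr (1 + s)) / 2"
proof -
  let ?F = "\<lambda>y. ((1 + y) powr (1 + s) + (1 - y) powr (1 + s)) / 2 - (1 + s) * s / 2 * y\<^sup>2"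
  have "?F 0 \<le> ?F y"
  proof (rule DERIV_nonneg_imp_increasing_open[where f = ?F])
    fix x assume x: "0 < x" "x < y"
    let ?D = "(1 + s) / 2 * ((1 + x) powr s - (1 - x) powr s - 2 * s * x)"
    have "(?F has_real_derivative ?D) (at x)"
      using x assms by (auto intro!: derivative_eq_intros simp: field_simps)
    moreover have "0 \<le> ?D"
      using x assms powr_diff_ge_linear[of x s] by simp
    ultimately show "\<exists>d. (?F has_real_derivative d) (at x) \<and> 0 \<le> d" by blast
  next
    show "continuous_on {0..y} ?F"
      using assms by (intro continuous_intros continuous_on_powr') auto
  qed (use assms in auto)
  then have "1 \<le> ?F y" by simp
  then show ?thesis by linarith
qed

lemma bernoulli_powr_le:
  fixes t c :: real
  assumes "0 \<le> t" "0 \<le> c" "c \<le> 1"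
  shows "(1 + t) powr c \<le> 1 + c * t"
proof -
  \<comment> \<open>Weighted AM-GM for the numbers \<open>1 + t\<close> and 1.\<close>
  have "1 powr (1 - c) * (1 + t) powr c \<le> (1 - c) * 1 + c * (1 + t)"
    using assms by (intro Youngs_inequality_0) auto
  then show ?thesis by (simp add: algebra_simps)
qed

text \<open>The \<open>L\<^sup>p\<close> norm, for nonnegative values, on two points of mass \<open>1/2\<close>.\<close>

definition mean2 :: "real \<Rightarrow> real \<Rightarrow> real \<Rightarrow> real" where
  "mean2 p u v = ((u powr p + v powr p) / 2) powr (1 / p)"

text \<open>The two-point case of \<open>\<parallel>T f\<parallel>\<^sub>2 \<le> \<parallel>f\<parallel>\<^sub>p\<close>, where \<open>T\<close> is the noise operator with parameter
  \<open>\<surd>\<epsilon>\<close>; two such operators compose to the one with parameter \<open>\<epsilon>\<close>.\<close>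

lemma two_point_hypercontractive:
  fixes u v \<epsilon> :: real
  assumes eps: "0 < \<epsilon>" "\<epsilon> < 1" and uv: "0 \<le> u" "0 \<le> v"
  shows "((u + v) / 2)\<^sup>2 + \<epsilon> * ((u - v) / 2)\<^sup>2 \<le> (mean2 (1 + \<epsilon>) u v)\<^sup>2"
  using uv
proof (induction v u rule: linorder_wlog)
  case (sym v u)
  have "((u - v) / 2)\<^sup>2 = ((v - u) / 2)\<^sup>2"
    by (simp add: power_divide power2_commute)
  then show ?case using sym by (simp add: mean2_def add.commute)
next
  case (le v u)
  define p m where "p = 1 + \<epsilon>" and "m = (u + v) / 2"
  have p: "0 < p" using eps by (simp add: p_def)
  show ?case
  proof (cases "m = 0")
    case True
    then have "u = 0" "v = 0" using le by (auto simp: m_def)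
    then show ?thesis by simp
  next
    case False
    then have m: "0 < m" using le by (simp add: m_def)
    define y where "y = (u - v) / 2 / m"
    have y: "0 \<le> y" "y \<le> 1" using m le by (auto simp: y_def m_def field_simps)
    have u: "u = m * (1 + y)" and v: "v = m * (1 - y)"
    proof -
      have my: "m * y = (u - v) / 2" using m by (simp add: y_def)
      show "u = m * (1 + y)" "v = m * (1 - y)"
        unfolding distrib_left right_diff_distrib my unfolding m_def by (simp_all add: field_simps)
    qed
    define A where "A = ((1 + y) powr p + (1 - y) powr p) / 2"
    have "(1 + \<epsilon> * y\<^sup>2) powr (p/2) \<le> 1 + p/2 * (\<epsilon> * y\<^sup>2)"
      using eps by (intro bernoulli_powr_le) (auto simp: p_def)
    also have "\<dots> \<le> A"
      using powr_mean_ge_quadratic[OF y eps] by (simp add: A_def p_def algebra_simps)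
    finally have "((1 + \<epsilon> * y\<^sup>2) powr (p/2)) powr (2/p) \<le> A powr (2/p)"
      using p by (intro powr_mono2) auto
    then have 1: "1 + \<epsilon> * y\<^sup>2 \<le> A powr (2/p)"
      using p eps by (simp add: powr_powr abs_of_nonneg)
    have "u powr p = m powr p * (1 + y) powr p" "v powr p = m powr p * (1 - y) powr p"
      using m y by (simp_all add: u v powr_mult)
    then have "(u powr p + v powr p) / 2 = m powr p * A"
      by (simp add: A_def distrib_left add_divide_distrib)
    moreover have "0 \<le> A" by (simp add: A_def)
    ultimately have "mean2 p u v = m * A powr (1/p)"
      using m p by (simp add: mean2_def powr_mult powr_powr)
    then have "(mean2 p u v)\<^sup>2 = m\<^sup>2 * A powr (2/p)"
      by (simp add: power_mult_distrib power2_eq_square flip: powr_add)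
    moreover have "((u + v) / 2)\<^sup>2 + \<epsilon> * ((u - v) / 2)\<^sup>2 = m\<^sup>2 * (1 + \<epsilon> * y\<^sup>2)"
      by (simp add: u v field_simps power2_eq_square)
    ultimately show ?thesis
      using 1 m by (simp add: p_def)
  qed
qed

definition noise :: "real \<Rightarrow> nat \<Rightarrow> nat \<Rightarrow> real" where
  "noise \<epsilon> a b = (if a = b then (1 + \<epsilon>) / 2 else (1 - \<epsilon>) / 2)"

lemma noise_nonneg: "0 < \<epsilon> \<Longrightarrow> \<epsilon> < 1 \<Longrightarrow> 0 \<le> noise \<epsilon> a b"
  by (simp add: noise_def)

text \<open>In terms of half-sums and half-differences the left-hand side is the value at \<open>F\<close> and \<open>G\<close> of a
  positive definite bilinear form, so Cauchy--Schwarz reduces the claim to the case \<open>F = G\<close>.\<close>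

lemma two_point_noise_bound:
  fixes F G :: "nat \<Rightarrow> real"
  assumes eps: "0 < \<epsilon>" "\<epsilon> < 1" and nonneg: "\<And>a. 0 \<le> F a" "\<And>b. 0 \<le> G b"
  shows "(\<Sum>a\<in>{0,1}. \<Sum>b\<in>{0,1}. noise \<epsilon> a b * (F a * G b)) / 2
    \<le> mean2 (1 + \<epsilon>) (F 0) (F 1) * mean2 (1 + \<epsilon>) (G 0) (G 1)"
proof -
  define m d m' d' where "m = (F 0 + F 1) / 2" and "d = (F 0 - F 1) / 2"
    and "m' = (G 0 + G 1) / 2" and "d' = (G 0 - G 1) / 2"
  let ?P = "mean2 (1 + \<epsilon>) (F 0) (F 1)" and ?Q = "mean2 (1 + \<epsilon>) (G 0) (G 1)"
  have "(\<Sum>a\<in>{0,1}. \<Sum>b\<in>{0,1}. noise \<epsilon> a b * (F a * G b)) / 2 = m * m' + \<epsilon> * d * d'"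
    by (simp add: noise_def m_def d_def m'_def d'_def field_simps)
  moreover have "(m * m' + \<epsilon> * d * d')\<^sup>2 \<le> (?P * ?Q)\<^sup>2"
  proof -
    have "0 \<le> \<epsilon> * (m * d' - d * m')\<^sup>2" using eps by simp
    then have "(m * m' + \<epsilon> * d * d')\<^sup>2 \<le> (m\<^sup>2 + \<epsilon> * d\<^sup>2) * (m'\<^sup>2 + \<epsilon> * d'\<^sup>2)"
      by (simp add: power2_eq_square algebra_simps)
    also have "\<dots> \<le> ?P\<^sup>2 * ?Q\<^sup>2"
      using eps nonneg unfolding m_def d_def m'_def d'_def
      by (intro mult_mono two_point_hypercontractive) auto
    finally show ?thesis by (simp add: power_mult_distrib)
  qed
  moreover have "0 \<le> ?P * ?Q" by (simp add: mean2_def)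
  ultimately show ?thesis using power2_le_imp_le by metis
qed

section \<open>Tensorisation\<close>

lemma finite_cube: "finite (cube n)"
  by (auto simp: cube_def intro!: finite_PiE)

lemma card_cube: "card (cube n) = 2 ^ n"
  by (simp add: cube_def card_PiE flip: numeral_2_eq_2)

lemma sum_cube_Suc:
  "(\<Sum>x\<in>cube (Suc n). h x) = (\<Sum>a\<in>{0,1}. \<Sum>x\<in>cube n. h (x(Suc n := a)))"
proof -
  have "cube (Suc n) = (\<lambda>(a, x). x(Suc n := a)) ` ({0,1} \<times> cube n)"
    unfolding cube_def by (simp add: atLeastAtMostSuc_conv PiE_insert_eq)
  moreover have "inj_on (\<lambda>(a, x). x(Suc n := a)) ({0,1} \<times> cube n)"
    unfolding cube_def by (rule inj_combinator) simp
  ultimately have "(\<Sum>x\<in>cube (Suc n). h x) =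
      (\<Sum>z\<in>{0,1} \<times> cube n. h ((\<lambda>(a, x). x(Suc n := a)) z))"
    by (simp only: sum.reindex comp_def)
  then show ?thesis by (simp only: sum.cartesian_product split_def)
qed

lemma restrict_cube_nonneg:
  assumes "\<And>x. x \<in> cube (Suc n) \<Longrightarrow> 0 \<le> h x" "x \<in> cube n" "a \<in> {0,1}"
  shows "0 \<le> h (x(Suc n := a))"
proof -
  have "x(Suc n := a) \<in> cube (Suc n)"
    using PiE_fun_upd[of a "\<lambda>_. {0,1}" "Suc n" x "{1..n}"] assms(2,3)
    by (simp add: cube_def atLeastAtMostSuc_conv)
  then show ?thesis by (rule assms(1))
qed

lemma cube_norm_nonneg: "0 \<le> cube_norm n p h"
  by (simp add: cube_norm_def)

lemma cube_norm_Suc: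
  assumes p: "0 < p"
  shows "cube_norm (Suc n) p h =
    mean2 p (cube_norm n p (\<lambda>x. h (x(Suc n := 0)))) (cube_norm n p (\<lambda>x. h (x(Suc n := 1))))"
proof -
  have pow: "cube_norm n p k powr p = 1 / 2 ^ n * (\<Sum>x\<in>cube n. \<bar>k x\<bar> powr p)" for k
    using p by (simp add: cube_norm_def powr_powr sum_nonneg)
  then show ?thesis
    unfolding mean2_def pow by (simp add: cube_norm_def sum_cube_Suc field_simps)
qed

text \<open>The conditional probability of \<open>Y = y\<close> given \<open>X = x\<close>.\<close>

definition cube_noise :: "nat \<Rightarrow> real \<Rightarrow> (nat \<Rightarrow> nat) \<Rightarrow> (nat \<Rightarrow> nat) \<Rightarrow> real" where
  "cube_noise n \<epsilon> x y = (\<Prod>i\<in>{1..n}. noise \<epsilon> (x i) (y i))"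

lemma cube_noise_Suc:
  "cube_noise (Suc n) \<epsilon> (x(Suc n := a)) (y(Suc n := b)) = noise \<epsilon> a b * cube_noise n \<epsilon> x y"
proof -
  have "(\<Prod>i=1..n. noise \<epsilon> ((x(Suc n := a)) i) ((y(Suc n := b)) i))
      = (\<Prod>i=1..n. noise \<epsilon> (x i) (y i))"
    by (rule prod.cong) auto
  then show ?thesis by (simp add: cube_noise_def)
qed

text \<open>Applying the induction hypothesis to each pair of restrictions replaces \<open>f\<close> and \<open>g\<close> by functions
  \<open>F\<close> and \<open>G\<close> of the last coordinate alone, whose values are the norms of the restrictions.\<close>

theorem cube_noise_hypercontractive:
  assumes eps: "0 < \<epsilon>" "\<epsilon> < 1"
    and nonneg: "\<And>x. x \<in> cube n \<Longrightarrow> 0 \<le> f x" "\<And>x. x \<in> cube n \<Longrightarrow> 0 \<le> g x"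
  shows "(\<Sum>x\<in>cube n. \<Sum>y\<in>cube n. cube_noise n \<epsilon> x y * (f x * g y)) / 2 ^ n
    \<le> cube_norm n (1 + \<epsilon>) f * cube_norm n (1 + \<epsilon>) g"
  using nonneg
proof (induction n arbitrary: f g)
  case 0
  have "cube 0 = {\<lambda>_. undefined}" by (simp add: cube_def)
  then show ?case using 0 eps by (simp add: cube_norm_def cube_noise_def powr_powr)
next
  case (Suc n)
  define F where "F a = cube_norm n (1 + \<epsilon>) (\<lambda>x. f (x(Suc n := a)))" for a
  define G where "G b = cube_norm n (1 + \<epsilon>) (\<lambda>y. g (y(Suc n := b)))" for b
  define S where "S a b = (\<Sum>x\<in>cube n. \<Sum>y\<in>cube n. cube_noise n \<epsilon> x y *
    (f (x(Suc n := a)) * g (y(Suc n := b)))) / 2 ^ n" for a b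
  have S: "S a b \<le> F a * G b" if "a \<in> {0,1}" "b \<in> {0,1}" for a b
    unfolding S_def F_def G_def
    using that Suc.prems by (intro Suc.IH restrict_cube_nonneg[of n f] restrict_cube_nonneg[of n g]) auto
  have "(\<Sum>x\<in>cube (Suc n). \<Sum>y\<in>cube (Suc n). cube_noise (Suc n) \<epsilon> x y * (f x * g y))
     = (\<Sum>a\<in>{0,1}. \<Sum>x\<in>cube n. \<Sum>b\<in>{0,1}. \<Sum>y\<in>cube n. noise \<epsilon> a b * (cube_noise n \<epsilon> x y *
         (f (x(Suc n := a)) * g (y(Suc n := b)))))"
    unfolding sum_cube_Suc cube_noise_Suc by (simp only: mult.assoc)
  also have "\<dots> = (\<Sum>a\<in>{0,1}. \<Sum>b\<in>{0,1}. \<Sum>x\<in>cube n. \<Sum>y\<in>cube n. noise \<epsilon> a b *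
      (cube_noise n \<epsilon> x y * (f (x(Suc n := a)) * g (y(Suc n := b)))))"
    by (intro sum.cong refl sum.swap)
  also have "\<dots> = 2 ^ n * (\<Sum>a\<in>{0,1}. \<Sum>b\<in>{0,1}. noise \<epsilon> a b * S a b)"
    unfolding S_def by (simp only: sum_distrib_left sum_divide_distrib) simp
  finally have "(\<Sum>x\<in>cube (Suc n). \<Sum>y\<in>cube (Suc n). cube_noise (Suc n) \<epsilon> x y * (f x * g y))
      / 2 ^ Suc n = (\<Sum>a\<in>{0,1}. \<Sum>b\<in>{0,1}. noise \<epsilon> a b * S a b) / 2"
    by (simp add: field_simps)
  also have "\<dots> \<le> (\<Sum>a\<in>{0,1}. \<Sum>b\<in>{0,1}. noise \<epsilon> a b * (F a * G b)) / 2"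
    using eps by (intro divide_right_mono sum_mono mult_left_mono S noise_nonneg) auto
  also have "\<dots> \<le> mean2 (1 + \<epsilon>) (F 0) (F 1) * mean2 (1 + \<epsilon>) (G 0) (G 1)"
    using eps by (intro two_point_noise_bound) (auto simp: F_def G_def cube_norm_nonneg)
  also have "\<dots> = cube_norm (Suc n) (1 + \<epsilon>) f * cube_norm (Suc n) (1 + \<epsilon>) g"
    using eps by (simp add: cube_norm_Suc F_def G_def)
  finally show ?case .
qed

section \<open>The joint law of the two points\<close>

text \<open>The uniform measure on the event \<open>X = x\<close> is the conditional law given that event. Under it the
  coordinates of \<open>Y\<close> are independent with marginals \<open>noise\<close>, so their product is the
  conditional probability of \<open>Y = y\<close>, to be weighted with \<open>2\<^sup>-\<^sup>n\<close> for \<open>X = x\<close>.\<close>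

lemma (in prob_space) joint_law_of_conditional_noise:
  assumes n: "1 \<le> n"
    and X: "X \<in> M \<rightarrow>\<^sub>M count_space (cube n)"
    and Y: "Y \<in> M \<rightarrow>\<^sub>M count_space (cube n)"
    and X_uniform: "distr M (count_space (cube n)) X = uniform_count_measure (cube n)"
    and Y_cond_indep: "prob_space.indep_vars (uniform_measure M {\<omega> \<in> space M. X \<omega> = x})
            (\<lambda>_. count_space {0, 1}) (\<lambda>i \<omega>. Y \<omega> i) {1..n}"
    and Y_cond_prob: "\<And>i. i \<in> {1..n} \<Longrightarrow>
          \<P>(\<omega> in M. X \<omega> i = Y \<omega> i \<bar> X \<omega> = x) = (1 + \<epsilon>) / 2"
    and x: "x \<in> cube n" and y: "y \<in> cube n"
  shows "prob {\<omega> \<in> space M. X \<omega> = x \<and> Y \<omega> = y} = cube_noise n \<epsilon> x y / 2 ^ n"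
proof -
  define A where "A = {\<omega> \<in> space M. X \<omega> = x}"
  let ?U = "uniform_measure M A"
  have A_vimage: "A = X -` {x} \<inter> space M" by (auto simp: A_def)
  have A[measurable]: "A \<in> events"
    unfolding A_vimage using x by (intro measurable_sets[OF X]) auto
  have "prob A = measure (distr M (count_space (cube n)) X) {x}"
    unfolding A_vimage using x by (intro measure_distr[symmetric] X) auto
  also have "\<dots> = 1 / 2 ^ n"
    unfolding X_uniform using x
    by (simp add: measure_uniform_count_measure finite_cube card_cube)
  finally have prob_A: "prob A = 1 / 2 ^ n" .
  interpret U: prob_space ?U
    by (rule prob_space_uniform_measure) (simp_all add: emeasure_eq_measure prob_A)
  have U_prob: "U.prob B = 2 ^ n * prob (A \<inter> B)" if "B \<in> events" for B
    using that by (subst measure_uniform_measure) (auto simp: emeasure_eq_measure prob_A)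
  have Y_sets: "{\<omega> \<in> space M. P (Y \<omega>)} \<in> events" for P
  proof -
    have "{\<omega> \<in> space M. P (Y \<omega>)} = Y -` {y \<in> cube n. P y} \<inter> space M"
      using measurable_space[OF Y] by auto
    then show ?thesis using measurable_sets[OF Y, of "{y \<in> cube n. P y}"] by auto
  qed
  have agree: "U.prob {\<omega> \<in> space M. Y \<omega> i = x i} = (1 + \<epsilon>) / 2" if i: "i \<in> {1..n}" for i
  proof -
    have "A \<inter> {\<omega> \<in> space M. Y \<omega> i = x i} = {\<omega> \<in> space M. X \<omega> i = Y \<omega> i \<and> X \<omega> = x}"
      by (auto simp: A_def)
    then show ?thesis
      using Y_cond_prob[OF i] prob_A U_prob[OF Y_sets[of "\<lambda>y. y i = x i"]]
      by (simp add: cond_prob_def A_def[symmetric] field_simps)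
  qed
  have coord: "U.prob {\<omega> \<in> space M. Y \<omega> i = y i} = noise \<epsilon> (x i) (y i)" if i: "i \<in> {1..n}" for i
  proof (cases "x i = y i")
    case True
    then show ?thesis using agree[OF i] by (simp add: noise_def)
  next
    case False
    \<comment> \<open>With only two values available, \<open>Y\<^sub>i = y\<^sub>i\<close> is the complement of \<open>Y\<^sub>i = x\<^sub>i\<close>.\<close>
    have bit: "z i = 0 \<or> z i = 1" if "z \<in> cube n" for z using i that by (auto simp: cube_def)
    have "Y \<omega> i = y i \<longleftrightarrow> Y \<omega> i \<noteq> x i" if "\<omega> \<in> space M" for \<omega>
      using bit[OF x] bit[OF y] bit[of "Y \<omega>"] measurable_space[OF Y that] False by auto
    then have "{\<omega> \<in> space M. Y \<omega> i = y i} = space ?U - {\<omega> \<in> space M. Y \<omega> i = x i}"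
      by auto
    then show ?thesis
      using U.prob_compl[of "{\<omega> \<in> space M. Y \<omega> i = x i}"] Y_sets[of "\<lambda>y. y i = x i"]
        agree[OF i] False
      by (simp add: noise_def field_simps)
  qed
  have "{\<omega> \<in> space M. Y \<omega> = y} = (\<Inter>i\<in>{1..n}. (\<lambda>\<omega>. Y \<omega> i) -` {y i} \<inter> space ?U)"
  proof -
    have "Y \<omega> = y \<longleftrightarrow> (\<forall>i\<in>{1..n}. Y \<omega> i = y i)" if "\<omega> \<in> space M" for \<omega>
      using measurable_space[OF Y that] y PiE_ext[of "Y \<omega>" "{1..n}" "\<lambda>_. {0, 1}" y]
      by (auto simp: cube_def)
    then show ?thesis using n by auto
  qed
  also have "U.prob \<dots> = (\<Prod>i\<in>{1..n}. U.prob ((\<lambda>\<omega>. Y \<omega> i) -` {y i} \<inter> space ?U))"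
    using n y by (intro U.indep_varsD[OF Y_cond_indep[folded A_def]]) (auto simp: cube_def)
  also have "\<dots> = cube_noise n \<epsilon> x y"
    unfolding cube_noise_def
  proof (rule prod.cong)
    fix i assume i: "i \<in> {1..n}"
    have "(\<lambda>\<omega>. Y \<omega> i) -` {y i} \<inter> space ?U = {\<omega> \<in> space M. Y \<omega> i = y i}" by auto
    then show "U.prob ((\<lambda>\<omega>. Y \<omega> i) -` {y i} \<inter> space ?U) = noise \<epsilon> (x i) (y i)"
      using coord[OF i] by simp
  qed simp
  finally have "2 ^ n * prob (A \<inter> {\<omega> \<in> space M. Y \<omega> = y}) = cube_noise n \<epsilon> x y"
    by (simp only: U_prob Y_sets[of "\<lambda>z. z = y"])
  moreover have "A \<inter> {\<omega> \<in> space M. Y \<omega> = y} = {\<omega> \<in> space M. X \<omega> = x \<and> Y \<omega> = y}"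
    by (auto simp: A_def)
  ultimately show ?thesis by (simp add: field_simps)
qed

lemma (in prob_space) expectation_finite_pair:
  fixes h :: "'b \<Rightarrow> 'b \<Rightarrow> real"
  assumes C: "finite C"
    and X: "X \<in> M \<rightarrow>\<^sub>M count_space C" and Y: "Y \<in> M \<rightarrow>\<^sub>M count_space C"
  shows "(\<integral>\<omega>. h (X \<omega>) (Y \<omega>) \<partial>M) =
    (\<Sum>x\<in>C. \<Sum>y\<in>C. prob {\<omega> \<in> space M. X \<omega> = x \<and> Y \<omega> = y} * h x y)"
proof -
  let ?B = "\<lambda>x y. {\<omega> \<in> space M. X \<omega> = x \<and> Y \<omega> = y}"
  have B: "?B x y \<in> events" if "x \<in> C" "y \<in> C" for x y
  proof -
    have "?B x y = (X -` {x} \<inter> space M) \<inter> (Y -` {y} \<inter> space M)" by auto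
    also have "\<dots> \<in> events"
      using that by (intro sets.Int measurable_sets[OF X] measurable_sets[OF Y]) auto
    finally show ?thesis .
  qed
  have "h (X \<omega>) (Y \<omega>) = (\<Sum>x\<in>C. \<Sum>y\<in>C. indicator (?B x y) \<omega> * h x y)" if "\<omega> \<in> space M" for \<omega>
  proof -
    have "(\<Sum>x\<in>C. \<Sum>y\<in>C. indicator (?B x y) \<omega> * h x y)
        = (\<Sum>x\<in>C. if x = X \<omega> then (\<Sum>y\<in>C. if y = Y \<omega> then h x y else 0) else 0)"
      using that by (intro sum.cong) (auto simp: indicator_def intro!: sum.cong)
    also have "\<dots> = h (X \<omega>) (Y \<omega>)"
      using C measurable_space[OF X that] measurable_space[OF Y that] by simp
    finally show ?thesis by simp
  qed
  then have "(\<integral>\<omega>. h (X \<omega>) (Y \<omega>) \<partial>M)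
      = (\<integral>\<omega>. (\<Sum>x\<in>C. \<Sum>y\<in>C. indicator (?B x y) \<omega> * h x y) \<partial>M)"
    by (rule Bochner_Integration.integral_cong[OF refl])
  also have "\<dots> = (\<Sum>x\<in>C. \<Sum>y\<in>C. (\<integral>\<omega>. indicator (?B x y) \<omega> * h x y \<partial>M))"
  proof -
    have I: "integrable M (\<lambda>\<omega>. indicator (?B x y) \<omega> * h x y)" if "x \<in> C" "y \<in> C" for x y
      using B[OF that] by (intro integrable_mult_left) (simp add: emeasure_eq_measure)
    have "(\<integral>\<omega>. (\<Sum>x\<in>C. \<Sum>y\<in>C. indicator (?B x y) \<omega> * h x y) \<partial>M)
        = (\<Sum>x\<in>C. (\<integral>\<omega>. (\<Sum>y\<in>C. indicator (?B x y) \<omega> * h x y) \<partial>M))"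
      by (intro Bochner_Integration.integral_sum Bochner_Integration.integrable_sum I)
    also have "\<dots> = (\<Sum>x\<in>C. \<Sum>y\<in>C. (\<integral>\<omega>. indicator (?B x y) \<omega> * h x y \<partial>M))"
      by (intro sum.cong refl Bochner_Integration.integral_sum I)
    finally show ?thesis .
  qed
  also have "\<dots> = (\<Sum>x\<in>C. \<Sum>y\<in>C. prob (?B x y) * h x y)"
    using B by (intro sum.cong refl) simp
  finally show ?thesis .
qed

section \<open>The inequality for random points\<close>

theorem theorem2p3:
  fixes n :: nat and \<epsilon> :: real
    and f g :: "(nat \<Rightarrow> nat) \<Rightarrow> real"
    and M :: "'a measure" and X Y :: "'a \<Rightarrow> nat \<Rightarrow> nat"
  assumes n: "1 \<le> n"
    and eps: "0 < \<epsilon>" "\<epsilon> < 1"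
    and f_nonneg: "\<And>x. x \<in> cube n \<Longrightarrow> 0 \<le> f x"
    and g_nonneg: "\<And>x. x \<in> cube n \<Longrightarrow> 0 \<le> g x"
    and M: "prob_space M"
    and X: "X \<in> M \<rightarrow>\<^sub>M count_space (cube n)"
    and Y: "Y \<in> M \<rightarrow>\<^sub>M count_space (cube n)"
    and X_uniform: "distr M (count_space (cube n)) X = uniform_count_measure (cube n)"
    and Y_cond_indep: "\<And>x. x \<in> cube n \<Longrightarrow>
          prob_space.indep_vars (uniform_measure M {\<omega> \<in> space M. X \<omega> = x})
            (\<lambda>_. count_space {0, 1}) (\<lambda>i \<omega>. Y \<omega> i) {1..n}"
    and Y_cond_prob: "\<And>x i. x \<in> cube n \<Longrightarrow> i \<in> {1..n} \<Longrightarrow>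
          \<P>(\<omega> in M. X \<omega> i = Y \<omega> i \<bar> X \<omega> = x) = (1 + \<epsilon>) / 2"
  shows "(\<integral>\<omega>. f (X \<omega>) * g (Y \<omega>) \<partial>M) \<le> cube_norm n (1 + \<epsilon>) f * cube_norm n (1 + \<epsilon>) g"
proof -
  interpret prob_space M by (rule M)
  have "(\<integral>\<omega>. f (X \<omega>) * g (Y \<omega>) \<partial>M)
      = (\<Sum>x\<in>cube n. \<Sum>y\<in>cube n. prob {\<omega> \<in> space M. X \<omega> = x \<and> Y \<omega> = y} * (f x * g y))"
    by (rule expectation_finite_pair[OF finite_cube X Y])
  also have "\<dots> = (\<Sum>x\<in>cube n. \<Sum>y\<in>cube n. cube_noise n \<epsilon> x y / 2 ^ n * (f x * g y))"
    using n X Y X_uniform Y_cond_indep Y_cond_prob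
    by (intro sum.cong refl arg_cong2[where f = "(*)"] joint_law_of_conditional_noise) auto
  also have "\<dots> = (\<Sum>x\<in>cube n. \<Sum>y\<in>cube n. cube_noise n \<epsilon> x y * (f x * g y)) / 2 ^ n"
    by (simp add: sum_divide_distrib)
  also have "\<dots> \<le> cube_norm n (1 + \<epsilon>) f * cube_norm n (1 + \<epsilon>) g"
    using eps f_nonneg g_nonneg by (rule cube_noise_hypercontractive)
  finally show ?thesis .
qed

end
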